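(* Let $M\ge0$ and consider the ADER-IWF-RK method built on the $M+1$ Gauss--Legendre nodes, with Butcher matrix $\underline{\underline{A}}$ and weights $b$ as defined in the context. Its stability function $$R(z)=1+z\,b^T(\underline{\underline{Id}}-z\underline{\underline{A}})^{-1}\underline{1}$$ is the $(M,M+1)$-Padé approximation to $e^z$ (numerator of degree $M$, denominator of degree $M+1$).
   Context: ADER-IWF-RK Gauss--Legendre method. Let $t^0,\dots,t^M$ be the $M+1$ Gauss--Legendre nodes on $[0,1]$, and let $\phi_0,\dots,\phi_M$ be the Lagrange basis polynomials of degree $M$ in these nodes, $\phi_i(t^j)=\delta_{ij}$. For $i,j=0,\dots,M$ define $$M_{ij}=\phi_i(1)\phi_j(1)-\int_0^1\phi_i'(t)\phi_j(t)\,dt,\qquad R_{ij}=\int_0^1\phi_i(t)\phi_j(t)\,dt=\delta_{ij}w_j,\qquad b_i=w_i=\int_0^1\phi_i(t)\,dt .$$ The matrix $\underline{\underline{M}}$ is invertible. The method is the implicit Runge--Kutta method with $M+1$ stages with Butcher matrix $\underline{\underline{A}}=\underline{\underline{Q}}:=\underline{\underline{M}}^{-1}\underline{\underline{R}}$ and weights $b$. Here $\underline{1}=(1,\dots,1)^T\in\mathbb{R}^{M+1}$ and $\underline{\underline{Id}}$ is the identity matrix. The $(k,j)$-Padé approximation to $e^z$ is the unique rational function $N(z)/D(z)$ with $\deg N\le k$, $\deg D\le j$, $D(0)=1$ and $e^z-N(z)/D(z)=O(z^{k+j+1})$ as $z\to0$. *)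

theory Defs
  imports
    "HOL-Analysis.Henstock_Kurzweil_Integration"
    "HOL-Library.Landau_Symbols"
    "HOL-Computational_Algebra.Polynomial"
    "Jordan_Normal_Form.Gauss_Jordan_Elimination"
begin

hide_type (open) Finite_Cartesian_Product.vec
hide_const (open) Finite_Cartesian_Product.vec module.smult

text \<open>Rodrigues' formula for the Legendre polynomials on \<open>[-1, 1]\<close>.\<close>

definition legendre_poly :: "nat \<Rightarrow> real poly" where
  "legendre_poly n = smult (1 / (2 ^ n * fact n)) ((pderiv ^^ n) ([:-1, 0, 1:] ^ n))"

text \<open>\<open>t 0, \<dots>, t M\<close> enumerates, in any order and without repetition, the Gauss--Legendre nodes on
  \<open>[0, 1]\<close>: the zeros of the Legendre polynomial of degree \<open>M + 1\<close> transported to \<open>[0, 1]\<close>.\<close>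

definition gauss_legendre_nodes :: "nat \<Rightarrow> (nat \<Rightarrow> real) \<Rightarrow> bool" where
  "gauss_legendre_nodes M t \<longleftrightarrow>
     bij_betw t {..M} {x. poly (legendre_poly (M + 1)) (2 * x - 1) = 0}"

definition lagrange_basis :: "nat \<Rightarrow> (nat \<Rightarrow> real) \<Rightarrow> nat \<Rightarrow> real poly" where
  "lagrange_basis M t i = (\<Prod>j\<in>{..M} - {i}. smult (1 / (t i - t j)) [:- t j, 1:])"

definition ader_M :: "nat \<Rightarrow> (nat \<Rightarrow> real) \<Rightarrow> real mat" where
  "ader_M M t = mat (M + 1) (M + 1) (\<lambda>(i, j).
     poly (lagrange_basis M t i) 1 * poly (lagrange_basis M t j) 1
     - integral {0..1} (\<lambda>s. poly (pderiv (lagrange_basis M t i)) s * poly (lagrange_basis M t j) s))"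

definition ader_R :: "nat \<Rightarrow> (nat \<Rightarrow> real) \<Rightarrow> real mat" where
  "ader_R M t = mat (M + 1) (M + 1) (\<lambda>(i, j).
     integral {0..1} (\<lambda>s. poly (lagrange_basis M t i) s * poly (lagrange_basis M t j) s))"

text \<open>\<open>mat_inverse\<close> returns \<open>None\<close> on singular matrices, about which \<open>the\<close> says nothing.\<close>

definition ader_A :: "nat \<Rightarrow> (nat \<Rightarrow> real) \<Rightarrow> real mat" where
  "ader_A M t = the (mat_inverse (ader_M M t)) * ader_R M t"

definition ader_b :: "nat \<Rightarrow> (nat \<Rightarrow> real) \<Rightarrow> real vec" where
  "ader_b M t = vec (M + 1) (\<lambda>i. integral {0..1} (poly (lagrange_basis M t i)))"

text \<open>The matrix \<open>Id - z A\<close>; the stability function is meaningful where it is invertible.\<close>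

definition rk_resolvent_mat :: "real mat \<Rightarrow> complex \<Rightarrow> complex mat" where
  "rk_resolvent_mat A z = 1\<^sub>m (dim_row A) - z \<cdot>\<^sub>m map_mat complex_of_real A"

definition stability_function :: "real mat \<Rightarrow> real vec \<Rightarrow> complex \<Rightarrow> complex" where
  "stability_function A b z =
     1 + z * scalar_prod (map_vec complex_of_real b)
               (the (mat_inverse (rk_resolvent_mat A z)) *\<^sub>v vec (dim_row A) (\<lambda>_. 1))"

text \<open>\<open>N / D\<close> is the \<open>(k, j)\<close>-Pade approximation to \<open>exp\<close>, \<open>k\<close> being the degree bound of the numerator.\<close>

definition pade_exp :: "nat \<Rightarrow> nat \<Rightarrow> complex poly \<Rightarrow> complex poly \<Rightarrow> bool" where
  "pade_exp k j N D \<longleftrightarrow> degree N \<le> k \<and> degree D \<le> j \<and> poly D 0 = 1 \<and>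
     (\<lambda>z. exp z - poly N z / poly D z) \<in> O[at 0](\<lambda>z. z ^ (k + j + 1))"

text \<open>The approximation is unique as a rational function.\<close>

lemma poly_bigo_zero:
  fixes P :: "complex poly"
  assumes "poly P \<in> O[at 0](\<lambda>z. z ^ n)" "degree P < n"
  shows "P = 0"
proof (rule ccontr)
  assume P: "P \<noteq> 0"
  define m where "m = order 0 P"
  obtain Q where Q: "P = [:0, 1:] ^ m * Q" "\<not> [:0, 1:] dvd Q"
    using order_decomp[OF P, of 0] by (auto simp: m_def)
  have Q0: "poly Q 0 \<noteq> 0" using Q(2) by (auto simp: poly_eq_0_iff_dvd)
  have mn: "m < n" using order_degree[OF P, of 0] assms(2) by (simp add: m_def)
  obtain c where c: "eventually (\<lambda>z. norm (poly P z) \<le> c * norm (z ^ n)) (at 0)"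
    using assms(1) by (auto elim: landau_o.bigE)
  have "eventually (\<lambda>z::complex. z \<noteq> 0) (at 0)" by (simp add: eventually_at_filter)
  with c have ev: "eventually (\<lambda>z. norm (poly Q z) \<le> c * norm z ^ (n - m)) (at 0)"
  proof eventually_elim
    case (elim z)
    have "norm z ^ m * norm (poly Q z) \<le> c * norm z ^ n"
      using elim by (simp add: Q(1) poly_power norm_mult norm_power)
    also have "norm z ^ n = norm z ^ m * norm z ^ (n - m)"
      using mn by (simp flip: power_add)
    finally have "norm z ^ m * norm (poly Q z) \<le> norm z ^ m * (c * norm z ^ (n - m))"
      by (simp add: mult_ac)
    thus ?case using elim by (simp add: mult_le_cancel_left_pos)
  qed
  have "((\<lambda>z::complex. c * norm z ^ (n - m)) \<longlongrightarrow> c * norm (0::complex) ^ (n - m)) (at 0)"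
    by (intro tendsto_intros)
  moreover have "c * norm (0::complex) ^ (n - m) = 0" using mn by simp
  ultimately have "((\<lambda>z::complex. c * norm z ^ (n - m)) \<longlongrightarrow> 0) (at 0)" by metis
  hence "(poly Q \<longlongrightarrow> 0) (at 0)" by (rule Lim_null_comparison[OF ev])
  moreover have "(poly Q \<longlongrightarrow> poly Q 0) (at 0)"
    using poly_isCont[of 0 Q] by (simp add: isCont_def)
  ultimately show False using Q0 tendsto_unique[OF trivial_limit_at] by metis
qed

lemma pade_exp_unique:
  assumes "pade_exp k j N D" "pade_exp k j N' D'"
  shows "N * D' = N' * D"
proof -
  let ?g = "\<lambda>z::complex. z ^ (k + j + 1)"
  have bnd: "(\<lambda>z. poly p z) \<in> O[at 0](\<lambda>_. 1)" for p :: "complex poly"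
    using poly_isCont[of 0 p] by (intro bigoI_tendsto[where c = "poly p 0"]) (auto simp: isCont_def)
  have nz: "eventually (\<lambda>z. poly p z \<noteq> 0) (at 0)" if "poly p 0 = 1" for p :: "complex poly"
    using poly_isCont[of 0 p] that tendsto_imp_eventually_ne[of "poly p" 1 "at 0" 0]
    by (simp add: isCont_def)
  have "(\<lambda>z. (exp z - poly N' z / poly D' z) - (exp z - poly N z / poly D z)) \<in> O[at 0](?g)"
    using assms by (intro sum_in_bigo(2)[of "\<lambda>z. exp z - poly N' z / poly D' z"]) (simp_all add: pade_exp_def del: power_Suc)
  from landau_o.big.mult[OF this bnd[of "D * D'"]]
  have "(\<lambda>z. ((exp z - poly N' z / poly D' z) - (exp z - poly N z / poly D z))
             * poly (D * D') z) \<in> O[at 0](?g)" by simp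
  also have "?this \<longleftrightarrow> poly (N * D' - N' * D) \<in> O[at 0](?g)"
  proof (rule landau_o.big.in_cong)
    have "poly D 0 = 1" "poly D' 0 = 1" using assms by (auto simp: pade_exp_def)
    from nz[OF this(1)] nz[OF this(2)]
    show "eventually (\<lambda>z. ((exp z - poly N' z / poly D' z) - (exp z - poly N z / poly D z))
             * poly (D * D') z = poly (N * D' - N' * D) z) (at 0)"
      by eventually_elim (simp add: field_simps)
  qed
  finally have "poly (N * D' - N' * D) \<in> O[at 0](?g)" .
  moreover have "degree (N * D' - N' * D) < k + j + 1"
  proof -
    have "degree (N * D') \<le> k + j" "degree (N' * D) \<le> k + j"
      using assms degree_mult_le[of N D'] degree_mult_le[of N' D]
      by (auto simp: pade_exp_def)
    thus ?thesis using degree_diff_le[of "N * D'" "k + j" "N' * D"] by simp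
  qed
  ultimately show ?thesis using poly_bigo_zero by fastforce
qed

text \<open>Nodes exist: Rolle's theorem shows that the Legendre polynomial of degree \<open>n\<close> has \<open>n\<close>
  distinct zeros in \<open>(-1, 1)\<close>.\<close>

lemma power_dvd_pderiv:
  fixes r :: "real poly"
  assumes "r ^ Suc m dvd p"
  shows "r ^ m dvd pderiv p"
proof -
  obtain s where s: "p = r ^ Suc m * s" using assms by auto
  have "pderiv p = r ^ m * (r * pderiv s + smult (of_nat (Suc m)) (pderiv r * s))"
    unfolding s by (simp add: pderiv_mult pderiv_power_Suc algebra_simps del: power_Suc) (simp add: algebra_simps)
  thus ?thesis by simp
qed

lemma power_dvd_pderiv_funpow:
  fixes r :: "real poly"
  assumes "k \<le> n"
  shows "r ^ (n - k) dvd (pderiv ^^ k) (r ^ n)"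
  using assms
proof (induction k)
  case (Suc k)
  then have "r ^ Suc (n - Suc k) dvd (pderiv ^^ k) (r ^ n)" by (simp add: Suc_diff_Suc del: power_Suc)
  thus ?case using power_dvd_pderiv by simp
qed simp

lemma rodrigues_interlacing:
  fixes n :: nat
  defines "q \<equiv> \<lambda>k. (pderiv ^^ k) ([:-1, 0, 1:] ^ n) :: real poly"
  assumes "k \<le> n"
  shows "\<exists>f. f 0 = (-1::real) \<and> f (Suc k) = 1 \<and> (\<forall>i\<le>k. f i < f (Suc i)) \<and>
             (\<forall>i\<in>{1..k}. poly (q k) (f i) = 0)"
  using assms(2)
proof (induction k)
  case 0
  show ?case by (rule exI[of _ "\<lambda>i. if i = 0 then -1 else 1"]) auto
next
  case (Suc k)
  then obtain f where f: "f 0 = -1" "f (Suc k) = 1" "\<And>i. i \<le> k \<Longrightarrow> f i < f (Suc i)"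
    "\<And>i. i \<in> {1..k} \<Longrightarrow> poly (q k) (f i) = 0" by auto
  have "[:-1, 0, 1::real:] ^ (n - k) dvd q k"
    using Suc.prems power_dvd_pderiv_funpow[of k n "[:-1, 0, 1:]"] by (simp add: q_def)
  moreover have "[:-1, 0, 1::real:] dvd [:-1, 0, 1:] ^ (n - k)"
    using Suc.prems by (intro dvd_power) auto
  ultimately have "[:-1, 0, 1::real:] dvd q k" by (rule dvd_trans[rotated])
  hence ends: "poly (q k) (-1) = 0" "poly (q k) 1 = 0" by (auto elim!: dvdE)
  have root: "poly (q k) (f i) = 0" if "i \<le> Suc k" for i
    using that f ends by (cases "i = 0"; cases "i = Suc k") auto
  have "\<exists>x. f i < x \<and> x < f (Suc i) \<and> poly (q (Suc k)) x = 0" if ik: "i \<le> k" for i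
  proof -
    obtain x where "f i < x" "x < f (Suc i)"
      "poly (q k) (f (Suc i)) - poly (q k) (f i) = (f (Suc i) - f i) * poly (pderiv (q k)) x"
      using poly_MVT[of "f i" "f (Suc i)" "q k"] f(3)[OF ik] by auto
    thus ?thesis using root[of i] root[of "Suc i"] ik by (intro exI[of _ x]) (auto simp: q_def)
  qed
  then obtain g where g: "\<And>i. i \<le> k \<Longrightarrow> f i < g i \<and> g i < f (Suc i) \<and> poly (q (Suc k)) (g i) = 0"
    by metis
  define h where "h i = (if i = 0 then -1 else if i \<le> Suc k then g (i - 1) else 1)" for i
  have "h i < h (Suc i)" if "i \<le> Suc k" for i
  proof (cases i)
    case 0
    thus ?thesis using g[of 0] f by (simp add: h_def)
  next
    case (Suc l)
    hence l: "l \<le> k" using that by simp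
    show ?thesis
    proof (cases "l = k")
      case True
      thus ?thesis using g[of k] f Suc by (simp add: h_def)
    next
      case False
      hence "Suc l \<le> k" using l by simp
      thus ?thesis using g[of l] g[of "Suc l"] Suc by (auto simp: h_def)
    qed
  qed
  moreover have "poly (q (Suc k)) (h i) = 0" if "i \<in> {1..Suc k}" for i
    using that g[of "i - 1"] by (auto simp: h_def)
  ultimately show ?case by (intro exI[of _ h]) (auto simp: h_def)
qed

lemma legendre_poly_roots:
  "finite {x. poly (legendre_poly n) x = 0}" "card {x. poly (legendre_poly n) x = 0} = n"
proof -
  let ?q = "(pderiv ^^ n) ([:-1, 0, 1:] ^ n) :: real poly"
  have roots: "{x. poly (legendre_poly n) x = 0} = {x. poly ?q x = 0}"
    by (auto simp: legendre_poly_def)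
  have degk: "degree ((pderiv ^^ k) p) = degree p - k" for k and p :: "real poly"
    by (induction k) (auto simp: degree_pderiv)
  have deg: "degree ?q = n" by (simp add: degk degree_power_eq)
  have nz: "?q \<noteq> 0"
    using deg by (cases "n = 0") auto
  show fin: "finite {x. poly (legendre_poly n) x = 0}"
    unfolding roots using nz by (rule poly_roots_finite)
  obtain f where f: "\<And>i. i \<le> n \<Longrightarrow> f i < (f (Suc i) :: real)"
    "\<And>i. i \<in> {1..n} \<Longrightarrow> poly ?q (f i) = 0"
    using rodrigues_interlacing[of n n] by blast
  have lt: "f i < f j" if "i < j" "j \<le> n" for i j
    using that
  proof (induction j)
    case (Suc j)
    then show ?case using f(1)[of j] by (cases "i = j") force+
  qed simp
  have "inj_on f {1..n}" by (rule linorder_inj_onI) (use lt in \<open>fastforce+\<close>)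
  moreover have "f ` {1..n} \<subseteq> {x. poly ?q x = 0}" using f(2) by auto
  ultimately have "n \<le> card {x. poly ?q x = 0}"
    using card_mono[OF fin[unfolded roots], of "f ` {1..n}"] by (simp add: card_image)
  moreover have "card {x. poly ?q x = 0} \<le> n"
    using card_poly_roots_bound[OF nz] deg by simp
  ultimately show "card {x. poly (legendre_poly n) x = 0} = n" by (simp add: roots)
qed

lemma gauss_legendre_nodes_exist: "\<exists>t. gauss_legendre_nodes M t"
proof -
  let ?X = "{x. poly (legendre_poly (M + 1)) x = 0}"
  let ?Y = "{x. poly (legendre_poly (M + 1)) (2 * x - 1) = 0}"
  have eq: "?Y = (\<lambda>x. (x + 1) / 2) ` ?X"
  proof (intro Set.set_eqI iffI)
    fix x assume "x \<in> ?Y"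
    thus "x \<in> (\<lambda>x. (x + 1) / 2) ` ?X" by (intro image_eqI[of _ _ "2 * x - 1"]) auto
  qed (auto simp: field_simps)
  have "finite ?Y" unfolding eq using legendre_poly_roots(1) by (rule finite_imageI)
  moreover have "card ?Y = M + 1"
    unfolding eq using legendre_poly_roots(2)[of "M + 1"] by (subst card_image) (auto simp: inj_on_def)
  ultimately have "\<exists>t. bij_betw t {..M} ?Y"
    using finite_same_card_bij[of "{..M}" ?Y] by auto
  thus ?thesis by (simp add: gauss_legendre_nodes_def)
qed

end

theory Submission
  imports
    Defs
    "HOL-Analysis.Equivalence_Lebesgue_Henstock_Integration"
    "Jordan_Normal_Form.Char_Poly"
begin

text \<open>
  The nodes are distinct, so vectors in \<open>\<complex>\<^sup>M\<^sup>+\<^sup>1\<close> are the nodal values of polynomials of degree at most \<open>M\<close>, and every entry of the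
  matrices is an exact integral of basis polynomials. Hence \<open>M - z R\<close> is the matrix, in the Lagrange
  basis, of the bilinear form
  \[ B_z(q, p) = q(1) p(1) - \int_0^1 q' p - z \int_0^1 q p = q(0) p(0) + \int_0^1 q (p' - z p), \]
  a weak form of \<open>p' = z p\<close> (\<open>ader_matrices_mult_nodal_values\<close>). Since \<open>B\<^sub>0(q, 1) = q(0)\<close>, a polynomial
  \<open>P\<close> of degree at most \<open>M\<close> with \<open>B\<^sub>z(q, P) = q(0) d\<close> for all test polynomials \<open>q\<close> has nodal values
  \<open>d (Id - z A)\<^sup>-\<^sup>1 1\<close>. Testing with \<open>q = 1\<close> gives \<open>P(1) - z \<integral> P = d\<close>, so that
  \<open>1 + z b\<^sup>T (Id - z A)\<^sup>-\<^sup>1 1 = P(1) / d\<close> (\<open>ader_stability_function\<close>).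

  Such a \<open>P\<close> comes from Hermite's proof of the Pade formula. Put \<open>F(t) = t\<^sup>M (t - 1)\<^sup>M\<^sup>+\<^sup>1\<close>, \<open>n = 2M + 1\<close> and
  \<open>S\<^sub>z = \<Sum>\<^sub>k z\<^sup>n\<^sup>-\<^sup>k F\<^sup>(\<^sup>k\<^sup>)\<close>. Then \<open>z S\<^sub>z - S\<^sub>z' = z\<^sup>n\<^sup>+\<^sup>1 F\<close>, and integrating against \<open>exp (z (1 - t))\<close> gives
  \[ e^z S_z(0) - S_z(1) = z^{n+1} \int_0^1 e^{z (1 - t)} F(t) dt. \]
  So \<open>D(z) = S\<^sub>z(0)\<close> and \<open>N(z) = S\<^sub>z(1)\<close> approximate \<open>exp\<close> to order \<open>2M + 2\<close>; the derivatives of \<open>F\<close> that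
  vanish at \<open>0\<close> and \<open>1\<close> bring their degrees in \<open>z\<close> down to \<open>M + 1\<close> and \<open>M\<close> (\<open>pade_exp_hermite\<close>).
  The part of \<open>S\<^sub>z\<close> that involves only \<open>F\<^sup>(\<^sup>k\<^sup>)\<close> with \<open>k > M\<close> is a polynomial \<open>P\<close> of degree at most \<open>M\<close> in \<open>t\<close>.
  It has the same value at \<open>1\<close> as \<open>S\<^sub>z\<close>, and \<open>z P - P'\<close> is a multiple of \<open>F\<^sup>(\<^sup>M\<^sup>+\<^sup>1\<^sup>)\<close>, whose integral
  against polynomials \<open>q\<close> of degree at most \<open>M\<close> is proportional to \<open>q(0)\<close>. This is the required identity, with
  \<open>d = D(z)\<close> (\<open>ader_form_hermite_sum\<close>), and it yields \<open>R(z) = P(1) / D(z) = N(z) / D(z)\<close>.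
\<close>

hide_const (open) Module.module.smult Finite_Cartesian_Product.vec

section \<open>Integrals of polynomials over the unit interval\<close>

definition unit_integral :: "'a::{real_normed_field, banach} poly \<Rightarrow> 'a" where
  "unit_integral p = integral {0..1} (\<lambda>s. poly p (of_real s))"

lemma has_integral_unit_integral:
  fixes p :: "'a::{real_normed_field, banach} poly"
  shows "((\<lambda>s. poly p (of_real s)) has_integral unit_integral p) {0..1}"
  unfolding unit_integral_def
  by (intro integrable_integral integrable_continuous_interval continuous_intros)

lemma unit_integral_unique:
  "((\<lambda>s. poly p (of_real s)) has_integral I) {0..1} \<Longrightarrow> unit_integral p = I"
  by (simp add: unit_integral_def integral_unique)

lemma unit_integral_add: "unit_integral (p + q) = unit_integral p + unit_integral q"
  using has_integral_add[OF has_integral_unit_integral[of p] has_integral_unit_integral[of q]]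
  by (intro unit_integral_unique) simp

lemma unit_integral_smult: "unit_integral (smult c p) = c * unit_integral p"
  using has_integral_mult_right[OF has_integral_unit_integral[of p], of c]
  by (intro unit_integral_unique) simp

lemma unit_integral_0 [simp]: "unit_integral 0 = 0"
  using unit_integral_smult[of 0 0] by simp

lemma unit_integral_sum: "unit_integral (\<Sum>i\<in>A. f i) = (\<Sum>i\<in>A. unit_integral (f i))"
  by (induction A rule: infinite_finite_induct) (simp_all add: unit_integral_add)

lemma unit_integral_map_of_real:
  "unit_integral (map_poly of_real p) = (of_real (unit_integral p) :: 'a::{real_normed_field, banach})"
  using has_integral_of_real[OF has_integral_unit_integral[of p], where 'b = 'a]
  by (intro unit_integral_unique) simp

lemma unit_integral_pderiv: "unit_integral (pderiv p) = poly p 1 - poly p 0"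
proof (intro unit_integral_unique)
  have "((\<lambda>s. poly (pderiv p) (of_real s)) has_integral poly p (of_real 1) - poly p (of_real 0)) {0..1}"
    by (intro fundamental_theorem_of_calculus has_vector_derivative_real_field poly_DERIV) simp
  thus "((\<lambda>s. poly (pderiv p) (of_real s)) has_integral poly p 1 - poly p 0) {0..1}"
    by simp
qed

lemma unit_integral_by_parts:
  "unit_integral (q * pderiv p) = poly q 1 * poly p 1 - poly q 0 * poly p 0 - unit_integral (pderiv q * p)"
  using unit_integral_pderiv[of "q * p"]
  by (simp add: pderiv_mult unit_integral_add algebra_simps)

text \<open>The orthogonality behind Rodrigues' formula: each of the \<open>m\<close> integrations by parts has vanishing
  boundary terms, and together they move all \<open>m\<close> derivatives onto \<open>q\<close>.\<close>

lemma unit_integral_mult_higher_pderiv_eq_0: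
  assumes "\<And>j. j < m \<Longrightarrow> poly ((pderiv ^^ j) F) 0 = 0 \<and> poly ((pderiv ^^ j) F) 1 = 0"
    and "(pderiv ^^ m) q = 0"
  shows "unit_integral (q * (pderiv ^^ m) F) = 0"
  using assms
proof (induction m arbitrary: q)
  case (Suc m)
  have "unit_integral (pderiv q * (pderiv ^^ m) F) = 0"
    using Suc.prems by (intro Suc.IH) (simp_all add: funpow_Suc_right del: funpow.simps)
  thus ?case using Suc.prems(1)[of m] by (simp add: unit_integral_by_parts)
qed simp

section \<open>The bilinear form of the method\<close>

text \<open>The bilinear form of \<open>M - z R\<close>: the weak form, with upwind flux at \<open>1\<close>, of \<open>p' = z p\<close> on \<open>[0, 1]\<close>.\<close>

definition ader_form :: "'a::{real_normed_field, banach} \<Rightarrow> 'a poly \<Rightarrow> 'a poly \<Rightarrow> 'a" where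
  "ader_form z q p =
     poly q 1 * poly p 1 - unit_integral (pderiv q * p) - z * unit_integral (q * p)"

lemma ader_form_sum_left:
  "ader_form z (\<Sum>i\<in>A. smult (c i) (f i)) p = (\<Sum>i\<in>A. c i * ader_form z (f i) p)"
  by (simp add: ader_form_def pderiv_sum pderiv_smult poly_sum sum_distrib_left sum_distrib_right
      unit_integral_sum unit_integral_smult sum_subtractf sum.distrib algebra_simps)

lemma ader_form_sum_right:
  "ader_form z q (\<Sum>i\<in>A. smult (c i) (f i)) = (\<Sum>i\<in>A. c i * ader_form z q (f i))"
  by (simp add: ader_form_def poly_sum sum_distrib_left sum_distrib_right
      unit_integral_sum unit_integral_smult sum_subtractf sum.distrib algebra_simps)

lemma ader_form_by_parts:
  "ader_form z q p = poly q 0 * poly p 0 + unit_integral (q * pderiv p) - z * unit_integral (q * p)"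
  by (simp add: ader_form_def unit_integral_by_parts)

section \<open>Lagrange interpolation and the matrices of the method\<close>

lemma degree_lagrange_basis:
  assumes "i \<le> M"
  shows "degree (lagrange_basis M t i) \<le> M"
proof -
  have "degree (lagrange_basis M t i) \<le> (\<Sum>j\<in>{..M} - {i}. degree (smult (1 / (t i - t j)) [:- t j, 1:]))"
    unfolding lagrange_basis_def by (rule order.trans[OF degree_prod_sum_le]) (simp_all add: o_def)
  also have "\<dots> \<le> (\<Sum>j\<in>{..M} - {i}. 1)"
    by (intro sum_mono) simp
  also have "\<dots> = M" using assms by simp
  finally show ?thesis .
qed

lemma poly_lagrange_basis_node:
  assumes "inj_on t {..M}" "i \<le> M" "j \<le> M"
  shows "poly (lagrange_basis M t i) (t j) = (if i = j then 1 else 0)"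
proof (cases "i = j")
  case True
  have "poly (smult (1 / (t i - t k)) [:- t k, 1:]) (t j) = 1" if "k \<in> {..M} - {i}" for k
  proof -
    have "t i \<noteq> t k" using that assms inj_onD[of t "{..M}" i k] by auto
    thus ?thesis using True by (simp flip: diff_divide_distrib)
  qed
  thus ?thesis using True by (simp add: lagrange_basis_def poly_prod)
next
  case False
  thus ?thesis using assms by (auto simp: lagrange_basis_def poly_prod)
qed

text \<open>Both sides have degree at most \<open>M\<close> and agree at \<open>M + 1\<close> distinct points.\<close>

lemma lagrange_expansion:
  fixes p :: "'a::{real_normed_field, banach} poly"
  assumes inj: "inj_on t {..M}" and deg: "degree p \<le> M"
  shows "(\<Sum>j\<le>M. smult (poly p (of_real (t j))) (map_poly of_real (lagrange_basis M t j))) = p"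
    (is "?q = p")
proof (rule ccontr)
  assume "?q \<noteq> p"
  hence nz: "?q - p \<noteq> 0" by simp
  have "degree ?q \<le> M"
    using degree_lagrange_basis
    by (intro degree_sum_le order.trans[OF degree_smult_le]) auto
  hence le: "degree (?q - p) \<le> M"
    using deg by (intro degree_diff_le)
  have "poly (?q - p) (of_real (t i)) = 0" if "i \<le> M" for i
    using that inj by (simp add: poly_sum poly_lagrange_basis_node if_distrib of_real_hom.poly_map_poly
        cong: if_cong)
  hence sub: "(\<lambda>i. of_real (t i)) ` {..M} \<subseteq> {x. poly (?q - p) x = 0}" by auto
  have "inj_on (\<lambda>i. of_real (t i) :: 'a) {..M}"
    using inj by (auto simp: inj_on_def)
  hence "M + 1 \<le> card {x. poly (?q - p) x = 0}"
    using card_mono[OF poly_roots_finite[OF nz] sub] by (simp add: card_image)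
  also have "\<dots> \<le> degree (?q - p)"
    using card_poly_roots_bound[OF nz] .
  finally show False using le by simp
qed

lemma ader_matrices_eq_form:
  fixes z :: "'a::{real_normed_field, banach}"
  shows "map_mat of_real (ader_M M t) - z \<cdot>\<^sub>m map_mat of_real (ader_R M t) =
    mat (M + 1) (M + 1) (\<lambda>(i, j). ader_form z (map_poly of_real (lagrange_basis M t i))
      (map_poly of_real (lagrange_basis M t j)))"
proof -
  \<comment> \<open>provides multiplicativity of \<open>map_poly of_real\<close>\<close>
  interpret poly_hom: map_poly_comm_semiring_hom "of_real :: real \<Rightarrow> 'a" ..
  have [simp]: "integral {0..1} (\<lambda>s. poly p s * poly q s) = unit_integral (p * q)" for p q :: "real poly"
    by (simp add: unit_integral_def)
  have [simp]: "poly (map_poly of_real p) 1 = (of_real (poly p 1) :: 'a)" for p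
    using of_real_hom.poly_map_poly[of p 1] by simp
  show ?thesis
    by (rule eq_matI)
      (auto simp: ader_M_def ader_R_def ader_form_def unit_integral_map_of_real
        simp flip: of_real_hom.map_poly_pderiv poly_hom.hom_mult)
qed

text \<open>This turns linear algebra into statements about polynomials: by Lagrange interpolation in the
  second argument, the matrix acts on a vector of nodal values by testing the interpolated
  polynomial against the basis.\<close>

lemma ader_matrices_mult_nodal_values:
  fixes p :: "'a::{real_normed_field, banach} poly"
  assumes "inj_on t {..M}" "degree p \<le> M"
  shows "(map_mat of_real (ader_M M t) - z \<cdot>\<^sub>m map_mat of_real (ader_R M t))
      *\<^sub>v vec (M + 1) (\<lambda>j. poly p (of_real (t j))) =
    vec (M + 1) (\<lambda>i. ader_form z (map_poly of_real (lagrange_basis M t i)) p)"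
proof (rule eq_vecI)
  fix i assume "i < dim_vec (vec (M + 1) (\<lambda>i. ader_form z (map_poly of_real (lagrange_basis M t i)) p))"
  hence i: "i \<le> M" by simp
  let ?L = "\<lambda>i. map_poly of_real (lagrange_basis M t i) :: 'a poly"
  have "ader_form z (?L i) p = ader_form z (?L i) (\<Sum>j\<le>M. smult (poly p (of_real (t j))) (?L j))"
    by (subst lagrange_expansion[OF assms]) (rule refl)
  also have "\<dots> = (\<Sum>j = 0..<M + 1. ader_form z (?L i) (?L j) * poly p (of_real (t j)))"
    by (simp add: ader_form_sum_right mult.commute atLeast0LessThan lessThan_Suc_atMost)
  finally show "((map_mat of_real (ader_M M t) - z \<cdot>\<^sub>m map_mat of_real (ader_R M t))
      *\<^sub>v vec (M + 1) (\<lambda>j. poly p (of_real (t j)))) $ i =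
    vec (M + 1) (\<lambda>i. ader_form z (?L i) p) $ i"
    unfolding ader_matrices_eq_form using i by (simp add: scalar_prod_def)
qed (simp add: ader_M_def ader_R_def)

text \<open>Nondegeneracy of the form at \<open>z = 0\<close>. The test polynomial \<open>t p'(t)\<close> removes the boundary term
  \<open>q(0) p(0)\<close> and leaves \<open>\<integral> t p'(t)\<^sup>2 = 0\<close>, so \<open>p\<close> is constant; the test polynomial \<open>1\<close> then shows
  that the constant is \<open>0\<close>.\<close>

lemma poly_eq_0_if_ader_form_0_eq_0:
  fixes p :: "real poly"
  assumes "\<And>q. degree q \<le> M \<Longrightarrow> ader_form 0 q p = 0" "degree p \<le> M"
  shows "p = 0"
proof -
  define q where "q = [:0, 1:] * pderiv p"
  have "degree q \<le> M"
  proof (cases "degree p")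
    case 0
    thus ?thesis by (simp add: q_def pderiv_eq_0_iff)
  next
    case (Suc n)
    thus ?thesis using assms(2) degree_mult_le[of "[:0, 1:]" "pderiv p"]
      by (simp add: q_def degree_pderiv)
  qed
  hence "unit_integral (q * pderiv p) = 0"
    using assms(1)[of q] by (simp add: ader_form_by_parts) (simp add: q_def)
  hence "integral {0..1} (\<lambda>s. s * (poly (pderiv p) s)\<^sup>2) = 0"
    by (simp add: unit_integral_def q_def power2_eq_square mult.assoc)
  hence zero: "\<forall>s\<in>{0..1}. s * (poly (pderiv p) s)\<^sup>2 = 0"
    by (subst (asm) integral_eq_0_iff) (auto intro!: continuous_intros)
  have "poly (pderiv p) s = 0" if "s \<in> {0<..1}" for s
    using bspec[OF zero, of s] that by simp
  hence "{0<..1} \<subseteq> {s. poly (pderiv p) s = 0}" by blast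
  hence "infinite {s. poly (pderiv p) s = 0}"
    using infinite_super[of "{0<..1::real}"] by simp
  hence "pderiv p = 0"
    using poly_roots_finite[of "pderiv p"] by auto
  hence "degree p = 0" by (simp add: pderiv_eq_0_iff)
  then obtain c where c: "p = [:c:]" by (rule degree_eq_zeroE)
  have "ader_form 0 1 p = 0" by (rule assms) simp
  thus ?thesis by (simp add: c ader_form_by_parts)
qed

lemma ader_M_inverse:
  assumes inj: "inj_on t {..M}"
  obtains B where "mat_inverse (ader_M M t) = Some B" "ader_M M t * B = 1\<^sub>m (M + 1)"
    "B * ader_M M t = 1\<^sub>m (M + 1)" "B \<in> carrier_mat (M + 1) (M + 1)"
proof -
  have A: "ader_M M t \<in> carrier_mat (M + 1) (M + 1)" by (simp add: ader_M_def)
  have "det (ader_M M t) \<noteq> 0"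
  proof
    assume "det (ader_M M t) = 0"
    then obtain v where v: "v \<in> carrier_vec (M + 1)" "v \<noteq> 0\<^sub>v (M + 1)"
      "ader_M M t *\<^sub>v v = 0\<^sub>v (M + 1)"
      using det_0_iff_vec_prod_zero[OF A] by auto
    define p where "p = (\<Sum>j\<le>M. smult (v $ j) (lagrange_basis M t j))"
    have degp: "degree p \<le> M"
      unfolding p_def using degree_lagrange_basis
      by (intro degree_sum_le order.trans[OF degree_smult_le]) auto
    have "poly p (t j) = v $ j" if "j \<le> M" for j
      using that inj by (simp add: p_def poly_sum poly_lagrange_basis_node if_distrib cong: if_cong)
    hence vp: "v = vec (M + 1) (\<lambda>j. poly p (of_real (t j)))"
      using v(1) by (intro eq_vecI) auto
    have "map_mat of_real (ader_M M t) - 0 \<cdot>\<^sub>m map_mat of_real (ader_R M t) = ader_M M t"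
      by (rule eq_matI) (auto simp: ader_M_def ader_R_def)
    hence "vec (M + 1) (\<lambda>i. ader_form 0 (map_poly of_real (lagrange_basis M t i)) p) = 0\<^sub>v (M + 1)"
      using ader_matrices_mult_nodal_values[OF inj degp, of 0] v(3) vp by simp
    hence "ader_form 0 (map_poly of_real (lagrange_basis M t i)) p = 0" if "i \<le> M" for i
      using that by (metis index_vec index_zero_vec(1) less_Suc_eq_le Suc_eq_plus1)
    hence "ader_form 0 q p = 0" if "degree q \<le> M" for q
      by (subst lagrange_expansion[OF inj that, symmetric]) (simp add: ader_form_sum_left)
    hence "p = 0" using poly_eq_0_if_ader_form_0_eq_0 degp by blast
    hence "v = 0\<^sub>v (M + 1)" unfolding vp by (intro eq_vecI) auto
    with v(2) show False by contradiction
  qed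
  from det_non_zero_imp_unit[OF A this, of "()"] obtain B where "mat_inverse (ader_M M t) = Some B"
    using mat_inverse(1)[OF A, where b = "()"] by (cases "mat_inverse (ader_M M t)") auto
  thus ?thesis using mat_inverse(2)[OF A] that by blast
qed

section \<open>Hermite's integral for the Pade approximation\<close>

text \<open>For \<open>degree F \<le> n\<close> and \<open>z \<noteq> 0\<close> this is, up to the factor \<open>z\<^sup>n\<^sup>+\<^sup>1\<close>, the polynomial solution \<open>S\<close> of \<open>z S - S' = F\<close>;
  clearing the negative powers of \<open>z\<close> makes it a polynomial in \<open>z\<close> as well.\<close>

definition hermite_sum :: "nat \<Rightarrow> 'a::field_char_0 \<Rightarrow> 'a poly \<Rightarrow> 'a poly" where
  "hermite_sum n z F = (\<Sum>k\<le>n. smult (z ^ (n - k)) ((pderiv ^^ k) F))"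

lemma hermite_sum_0: "hermite_sum 0 z F = F"
  by (simp add: hermite_sum_def)

lemma hermite_sum_Suc:
  "hermite_sum (Suc n) z F = smult z (hermite_sum n z F) + (pderiv ^^ Suc n) F"
  by (simp add: hermite_sum_def smult_sum2 Suc_diff_le)

lemma hermite_sum_param_0: "hermite_sum n 0 F = (pderiv ^^ n) F"
  by (cases n) (simp_all add: hermite_sum_0 hermite_sum_Suc)

text \<open>Separates the derivatives of order at most \<open>m\<close>, which will vanish at the end points, from the
  higher ones, which form a polynomial of lower degree.\<close>

lemma hermite_sum_add:
  "hermite_sum (Suc m + n) z F =
     smult (z ^ Suc n) (hermite_sum m z F) + hermite_sum n z ((pderiv ^^ Suc m) F)"
proof (induction n)
  case 0
  thus ?case by (simp add: hermite_sum_Suc hermite_sum_0)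
next
  case (Suc n)
  have "(pderiv ^^ (Suc m + Suc n)) F = (pderiv ^^ Suc n) ((pderiv ^^ Suc m) F)"
    by (simp only: add.commute[of "Suc m"] funpow_add o_apply)
  thus ?case using Suc
    by (simp only: add_Suc_right hermite_sum_Suc) (simp add: smult_add_right add_ac mult_ac)
qed

text \<open>The sum telescopes, and the remaining derivative of order \<open>n + 1\<close> of \<open>F\<close> is zero.\<close>

lemma hermite_sum_ode:
  assumes "degree F \<le> n"
  shows "smult z (hermite_sum n z F) - pderiv (hermite_sum n z F) = smult (z ^ Suc n) F"
proof -
  have "smult z (hermite_sum n z F) - pderiv (hermite_sum n z F) =
    smult (z ^ Suc n) F - (pderiv ^^ Suc n) F"
  proof (induction n)
    case (Suc n)
    have "smult z (hermite_sum (Suc n) z F) - pderiv (hermite_sum (Suc n) z F) =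
      smult z (smult z (hermite_sum n z F) - pderiv (hermite_sum n z F))
       + smult z ((pderiv ^^ Suc n) F) - (pderiv ^^ Suc (Suc n)) F"
      by (simp add: hermite_sum_Suc pderiv_add pderiv_smult algebra_simps smult_add_right smult_diff_right)
    thus ?case by (simp only: Suc.IH) (simp add: algebra_simps smult_diff_right)
  qed (simp add: hermite_sum_0)
  moreover have "(pderiv ^^ Suc n) F = 0"
    using assms by (simp add: pderiv_eq_0_iff degree_higher_pderiv)
  ultimately show ?thesis by simp
qed

text \<open>The value at \<open>a\<close> of the previous sum, as a polynomial in the parameter \<open>z\<close>.\<close>

definition hermite_value :: "nat \<Rightarrow> 'a::field_char_0 poly \<Rightarrow> 'a \<Rightarrow> 'a poly" where
  "hermite_value n F a = (\<Sum>k\<le>n. monom (poly ((pderiv ^^ k) F) a) (n - k))"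

lemma poly_hermite_value: "poly (hermite_value n F a) z = poly (hermite_sum n z F) a"
  by (simp add: hermite_value_def hermite_sum_def poly_sum poly_monom mult.commute)

lemma coeff_hermite_value:
  "coeff (hermite_value n F a) i = (if i \<le> n then poly ((pderiv ^^ (n - i)) F) a else 0)"
proof -
  have "coeff (hermite_value n F a) i =
      (\<Sum>k\<le>n. if k = n - i \<and> i \<le> n then poly ((pderiv ^^ k) F) a else 0)"
    unfolding hermite_value_def coeff_sum by (intro sum.cong) auto
  thus ?thesis by (cases "i \<le> n") simp_all
qed

lemma order_higher_pderiv:
  fixes F :: "'a::field_char_0 poly"
  assumes "F \<noteq> 0" "k \<le> order a F"
  shows "(pderiv ^^ k) F \<noteq> 0 \<and> order a ((pderiv ^^ k) F) = order a F - k"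
  using assms(2)
proof (induction k)
  case (Suc k)
  hence IH: "(pderiv ^^ k) F \<noteq> 0" "order a ((pderiv ^^ k) F) = order a F - k" by auto
  hence root: "poly ((pderiv ^^ k) F) a = 0" using Suc.prems by (simp add: order_root)
  have "pderiv ((pderiv ^^ k) F) \<noteq> 0"
  proof
    assume "pderiv ((pderiv ^^ k) F) = 0"
    hence "degree ((pderiv ^^ k) F) = 0" by (simp only: pderiv_eq_0_iff)
    then obtain c where "(pderiv ^^ k) F = [:c:]" by (rule degree_eq_zeroE)
    thus False using IH root by simp
  qed
  thus ?case using order_pderiv[OF IH(1) root] IH(2) by simp
qed (use assms in simp)

lemma poly_higher_pderiv_eq_0_iff:
  fixes F :: "'a::field_char_0 poly"
  assumes "F \<noteq> 0" "k \<le> order a F"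
  shows "poly ((pderiv ^^ k) F) a = 0 \<longleftrightarrow> k < order a F"
  using order_higher_pderiv[OF assms] assms(2) by (auto simp: order_root)

lemma coeff_higher_pderiv_degree_neq_0:
  fixes F :: "'a::field_char_0 poly"
  assumes "F \<noteq> 0"
  shows "coeff ((pderiv ^^ degree F) F) 0 \<noteq> 0"
  using assms by (simp add: coeff_higher_pderiv flip: pochhammer_fact)

text \<open>The coefficients of the highest powers of \<open>z\<close> are the lowest derivatives of \<open>F\<close> at \<open>a\<close>, and these
  vanish precisely below the order of \<open>a\<close> as a root.\<close>

lemma degree_hermite_value:
  fixes F :: "'a::field_char_0 poly"
  assumes "F \<noteq> 0" "order a F \<le> n"
  shows "degree (hermite_value n F a) = n - order a F"
proof (rule antisym)
  show "degree (hermite_value n F a) \<le> n - order a F"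
  proof (rule degree_le, intro allI impI)
    fix i assume "n - order a F < i"
    thus "coeff (hermite_value n F a) i = 0"
      using poly_higher_pderiv_eq_0_iff[OF assms(1), of "n - i" a] assms(2)
      by (auto simp: coeff_hermite_value)
  qed
  show "n - order a F \<le> degree (hermite_value n F a)"
    using poly_higher_pderiv_eq_0_iff[OF assms(1) order.refl, of a] assms(2)
    by (intro le_degree) (simp add: coeff_hermite_value)
qed

text \<open>Hermite's identity: by \<open>hermite_sum_ode\<close>, the function \<open>- exp (z (1 - t)) S(t)\<close> is an antiderivative
  in \<open>t\<close> of the integrand times \<open>z\<^sup>n\<^sup>+\<^sup>1\<close>.\<close>

lemma exp_hermite_value:
  fixes F :: "complex poly"
  assumes "degree F \<le> n"
  shows "exp z * poly (hermite_value n F 0) z - poly (hermite_value n F 1) z =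
    z ^ Suc n * integral {0..1} (\<lambda>s. exp (z * (1 - of_real s)) * poly F (of_real s))"
proof -
  let ?S = "hermite_sum n z F"
  let ?g = "\<lambda>t. - (exp (z * (1 - t)) * poly ?S t)"
  have ode: "z * poly ?S t - poly (pderiv ?S) t = z ^ Suc n * poly F t" for t
    using arg_cong[OF hermite_sum_ode[OF assms, of z], of "\<lambda>p. poly p t"] by simp
  have "(?g has_field_derivative z ^ Suc n * (exp (z * (1 - t)) * poly F t)) (at t)" for t
  proof -
    have "(?g has_field_derivative exp (z * (1 - t)) * (z * poly ?S t - poly (pderiv ?S) t)) (at t)"
      by (auto intro!: derivative_eq_intros simp: algebra_simps)
    thus ?thesis by (simp only: ode) (simp add: mult_ac)
  qed
  hence "((\<lambda>s. z ^ Suc n * (exp (z * (1 - of_real s)) * poly F (of_real s))) has_integral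
      ?g (of_real 1) - ?g (of_real 0)) {0..1}"
    by (intro fundamental_theorem_of_calculus has_vector_derivative_real_field) simp_all
  hence "integral {0..1} (\<lambda>s. z ^ Suc n * (exp (z * (1 - of_real s)) * poly F (of_real s))) =
      ?g (of_real 1) - ?g (of_real 0)"
    by (rule integral_unique)
  thus ?thesis by (simp add: poly_hermite_value del: power_Suc)
qed

text \<open>The integral in Hermite's identity stays bounded as \<open>z \<rightarrow> 0\<close>, so its factor \<open>z\<^sup>n\<^sup>+\<^sup>1\<close> is the order of
  approximation. Dividing by \<open>c\<close>, which is \<open>n!\<close> times the leading coefficient of \<open>F\<close>, achieves \<open>D(0) = 1\<close>. With
  \<open>F = t\<^sup>k (t - 1)\<^sup>j\<close> this covers every entry of the Pade table.\<close>

lemma pade_exp_hermite: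
  fixes F :: "complex poly"
  assumes F: "F \<noteq> 0" and deg: "degree F = order 0 F + order 1 F"
  defines "n \<equiv> degree F"
  defines "c \<equiv> poly (hermite_value n F 0) 0"
  shows "c \<noteq> 0"
    and "pade_exp (order 0 F) (order 1 F) (smult (1 / c) (hermite_value n F 1))
           (smult (1 / c) (hermite_value n F 0))"
proof -
  let ?N = "hermite_value n F 1" and ?D = "hermite_value n F 0"
  show c: "c \<noteq> 0"
    using coeff_higher_pderiv_degree_neq_0[OF F]
    by (simp add: c_def n_def poly_0_coeff_0 coeff_hermite_value)
  have D0: "poly ?D 0 = c" by (simp add: c_def)
  have degs: "degree ?N = order 0 F" "degree ?D = order 1 F"
    using deg F by (simp_all add: degree_hermite_value n_def)
  define I where "I z = integral {0..1} (\<lambda>s. exp (z * (1 - of_real s)) * poly F (of_real s))" for z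
  \<comment> \<open>on the unit disc, \<open>exp 1\<close> times a bound for \<open>F\<close> on \<open>[0, 1]\<close> bounds the integral\<close>
  obtain B where B: "\<And>s. s \<in> {0..1::real} \<Longrightarrow> norm (poly F (of_real s)) \<le> B"
  proof -
    have "compact ((\<lambda>s. poly F (of_real s)) ` {0..1::real})"
      by (intro compact_continuous_image continuous_intros) simp
    from compact_imp_bounded[OF this] obtain a
      where "\<forall>x\<in>(\<lambda>s. poly F (of_real s)) ` {0..1::real}. norm x \<le> a"
      unfolding bounded_iff by blast
    thus ?thesis by (intro that[of a]) blast
  qed
  have "norm (I z) \<le> exp 1 * B" if z: "norm z < 1" for z
  proof -
    have "norm (exp (z * (1 - of_real s)) * poly F (of_real s)) \<le> exp 1 * B" if s: "s \<in> {0..1}" for s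
    proof -
      have "norm (exp (z * (1 - complex_of_real s))) \<le> exp (norm (z * (1 - complex_of_real s)))"
        by (rule norm_exp)
      also have "norm (z * (1 - complex_of_real s)) = norm z * (1 - s)"
        using s norm_of_real[of "1 - s", where 'a = complex] by (simp add: norm_mult)
      also have "\<dots> \<le> 1 * 1" using z s by (intro mult_mono) auto
      finally have "norm (exp (z * (1 - complex_of_real s))) \<le> exp 1" by simp
      thus ?thesis using B[OF s] by (simp add: norm_mult mult_mono)
    qed
    hence "norm (I z) \<le> exp 1 * B * (1 - 0)"
      unfolding I_def by (intro integral_bound continuous_intros) auto
    thus ?thesis by simp
  qed
  hence bnd: "I \<in> O[at 0](\<lambda>_. 1)"
    by (intro bigoI[of _ "exp 1 * B"]) (auto simp: eventually_at intro!: exI[of _ 1])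
  have lim: "(poly ?D \<longlongrightarrow> c) (at 0)"
    using poly_isCont[of 0 ?D] by (simp add: isCont_def c_def)
  hence "((\<lambda>z. 1 / poly ?D z) \<longlongrightarrow> 1 / c) (at 0)"
    using c by (intro tendsto_intros)
  hence "(\<lambda>z. 1 / poly ?D z) \<in> O[at 0](\<lambda>_. 1)"
    by (intro bigoI_tendsto[where c = "1 / c"]) auto
  from landau_o.big.mult[OF landau_o.big_refl[of "\<lambda>z. z ^ Suc n"] landau_o.big.mult[OF bnd this]]
  have mem: "(\<lambda>z. z ^ Suc n * (I z * (1 / poly ?D z))) \<in> O[at 0](\<lambda>z. z ^ Suc n)"
    by simp
  have ev: "eventually (\<lambda>z. z ^ Suc n * (I z * (1 / poly ?D z)) =
      exp z - poly (smult (1 / c) ?N) z / poly (smult (1 / c) ?D) z) (at 0)"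
    using tendsto_imp_eventually_ne[OF lim c]
  proof eventually_elim
    case (elim z)
    thus ?case using exp_hermite_value[of F n z] c
      by (simp add: n_def I_def field_simps)
  qed
  have "(\<lambda>z. exp z - poly (smult (1 / c) ?N) z / poly (smult (1 / c) ?D) z)
      \<in> O[at 0](\<lambda>z. z ^ Suc n)"
    by (rule iffD1[OF landau_o.big.in_cong[OF ev] mem])
  thus "pade_exp (order 0 F) (order 1 F) (smult (1 / c) ?N) (smult (1 / c) ?D)"
    unfolding pade_exp_def using degs c D0 deg by (simp add: n_def)
qed

lemma two_root_poly:
  fixes m k :: nat
  defines "F \<equiv> [:0, 1:] ^ m * [:-1, 1:] ^ k :: 'a::field_char_0 poly"
  shows "F \<noteq> 0" "order 0 F = m" "order 1 F = k" "degree F = m + k"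
proof -
  show F: "F \<noteq> 0" by (simp add: F_def)
  show "order 0 F = m" "order 1 F = k"
    using F order_power_n_n[of "0::'a" m] order_power_n_n[of "1::'a" k]
    by (simp_all add: F_def order_mult order_0I poly_power)
  show "degree F = m + k"
    by (simp add: F_def degree_mult_eq degree_power_eq)
qed

section \<open>The stage polynomial and the stability function\<close>

text \<open>
  The polynomial \<open>P\<close> is Hermite's sum without the derivatives of \<open>F\<close> of order at most \<open>M\<close>. These all
  vanish at \<open>1\<close>, and at \<open>0\<close> only the one of order \<open>M\<close> survives. Since
  \<open>P' - z P = - z\<^sup>M\<^sup>+\<^sup>1 F\<^sup>(\<^sup>M\<^sup>+\<^sup>1\<^sup>)\<close> and \<open>\<integral> q F\<^sup>(\<^sup>M\<^sup>+\<^sup>1\<^sup>) = - q(0) F\<^sup>(\<^sup>M\<^sup>)(0)\<close>, the form equals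
  \<open>q(0) (P(0) + z\<^sup>M\<^sup>+\<^sup>1 F\<^sup>(\<^sup>M\<^sup>)(0))\<close>, in which the surviving term completes \<open>P(0)\<close> to the value at \<open>0\<close>
  of the full sum.
\<close>

lemma ader_form_hermite_sum:
  fixes F :: "'a::{real_normed_field, banach} poly" and z :: 'a
  assumes F: "F \<noteq> 0" and deg: "degree F = 2 * M + 1" and ord: "order 0 F = M" "order 1 F = M + 1"
  defines "P \<equiv> hermite_sum M z ((pderiv ^^ Suc M) F)"
  shows "degree P \<le> M"
    and "poly P 1 = poly (hermite_value (2 * M + 1) F 1) z"
    and "degree q \<le> M \<Longrightarrow> ader_form z q P = poly q 0 * poly (hermite_value (2 * M + 1) F 0) z"
    and "P \<noteq> 0"
proof -
  have split: "hermite_sum (2 * M + 1) z F = smult (z ^ Suc M) (hermite_sum M z F) + P"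
    using hermite_sum_add[of M M z F] by (simp add: P_def mult_2)
  have at0: "poly ((pderiv ^^ k) F) 0 = 0" if "k < M" for k
    using poly_higher_pderiv_eq_0_iff[OF F, of k 0] that ord by simp
  have at1: "poly ((pderiv ^^ k) F) 1 = 0" if "k \<le> M" for k
    using poly_higher_pderiv_eq_0_iff[OF F, of k 1] that ord by simp
  have degF: "degree ((pderiv ^^ Suc M) F) = M"
    unfolding degree_higher_pderiv deg by simp
  have "degree ((pderiv ^^ k) ((pderiv ^^ Suc M) F)) \<le> M" for k
    by (rule order.trans[OF eq_refl[OF degree_higher_pderiv]]) (use degF in simp)
  thus "degree P \<le> M"
    unfolding P_def hermite_sum_def
    by (intro degree_sum_le order.trans[OF degree_smult_le]) auto
  have "poly (hermite_sum M z F) 1 = 0"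
    by (simp add: hermite_sum_def poly_sum at1)
  thus "poly P 1 = poly (hermite_value (2 * M + 1) F 1) z"
    unfolding poly_hermite_value split by simp
  have "smult z P - pderiv P = smult (z ^ Suc M) ((pderiv ^^ Suc M) F)"
    unfolding P_def by (rule hermite_sum_ode) (simp only: degF)
  hence ode: "pderiv P = smult z P - smult (z ^ Suc M) ((pderiv ^^ Suc M) F)"
    by (metis diff_diff_eq2 add_diff_cancel_left')
  show "ader_form z q P = poly q 0 * poly (hermite_value (2 * M + 1) F 0) z" if q: "degree q \<le> M"
  proof -
    have "poly (hermite_sum M z F) 0 =
        (\<Sum>k\<le>M. if k = M then poly ((pderiv ^^ M) F) 0 else 0)"
      unfolding hermite_sum_def poly_sum by (intro sum.cong) (auto simp: at0)
    hence D: "poly (hermite_value (2 * M + 1) F 0) z = z ^ Suc M * poly ((pderiv ^^ M) F) 0 + poly P 0"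
      unfolding poly_hermite_value split by simp
    have "(pderiv ^^ M) (pderiv q) = (pderiv ^^ Suc M) q"
      by (simp only: funpow_Suc_right o_apply)
    also have "\<dots> = 0"
      using q by (simp add: pderiv_eq_0_iff degree_higher_pderiv)
    finally have "unit_integral (pderiv q * (pderiv ^^ M) F) = 0"
      using at0 at1 by (intro unit_integral_mult_higher_pderiv_eq_0) auto
    hence I: "unit_integral (q * (pderiv ^^ Suc M) F) = - (poly q 0 * poly ((pderiv ^^ M) F) 0)"
      using at1[of M] by (simp add: unit_integral_by_parts)
    have "unit_integral (q * pderiv P) =
        unit_integral (smult z (q * P) + smult (- (z ^ Suc M)) (q * (pderiv ^^ Suc M) F))"
      unfolding ode by (rule arg_cong[of _ _ unit_integral]) (simp add: algebra_simps)
    also have "\<dots> = z * unit_integral (q * P) + z ^ Suc M * (poly q 0 * poly ((pderiv ^^ M) F) 0)"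
      by (simp only: unit_integral_add unit_integral_smult I) simp
    finally have "unit_integral (q * pderiv P) =
      z * unit_integral (q * P) + z ^ Suc M * (poly q 0 * poly ((pderiv ^^ M) F) 0)" .
    thus ?thesis unfolding ader_form_by_parts D by (simp add: algebra_simps)
  qed
  show "P \<noteq> 0"
  proof
    assume P0: "P = 0"
    have nz: "(pderiv ^^ Suc M) F \<noteq> 0"
      using order_higher_pderiv[OF F, of "Suc M" 1] ord by simp
    with ode P0 have "z = 0" by auto
    hence "P = (pderiv ^^ M) ((pderiv ^^ Suc M) F)"
      unfolding P_def by (simp only: hermite_sum_param_0)
    with P0 coeff_higher_pderiv_degree_neq_0[OF nz] show False
      by (simp only: degF) simp
  qed
qed

lemma invertible_mat_inverse:
  fixes T :: "'a::field mat"
  assumes "T \<in> carrier_mat n n" "invertible_mat T"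
  obtains B where "mat_inverse T = Some B" "T * B = 1\<^sub>m n" "B * T = 1\<^sub>m n" "B \<in> carrier_mat n n"
proof -
  obtain C where C: "T * C = 1\<^sub>m (dim_row T)" "C * T = 1\<^sub>m (dim_row C)"
    using assms(2) by (auto simp: invertible_mat_def inverts_mat_def)
  have "dim_row C = n" "dim_col C = n"
    using arg_cong[OF C(1), of dim_col] arg_cong[OF C(2), of dim_col] assms(1) by auto
  hence "T \<in> Units (ring_mat TYPE('a) n ())"
    using C assms(1) unfolding Units_def by (auto simp: ring_mat_simps intro!: bexI[of _ C])
  then obtain B where "mat_inverse T = Some B"
    using mat_inverse(1)[OF assms(1), where b = "()"] by (cases "mat_inverse T") auto
  thus ?thesis using mat_inverse(2)[OF assms(1)] that by blast
qed

text \<open>The constant polynomial \<open>d\<close> satisfies the same equations as \<open>P\<close>, but with parameter \<open>0\<close> instead of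
  \<open>z\<close>: in matrices, \<open>(M - z R) v = M (d 1)\<close>. Multiplying by the inverse of \<open>M\<close> turns the left-hand side
  into \<open>(Id - z A) v\<close>.\<close>

lemma ader_resolvent_mult:
  fixes P :: "complex poly"
  assumes inj: "inj_on t {..M}" and deg: "degree P \<le> M"
    and form: "\<And>q. degree q \<le> M \<Longrightarrow> ader_form z q P = poly q 0 * d"
  shows "rk_resolvent_mat (ader_A M t) z *\<^sub>v vec (M + 1) (\<lambda>j. poly P (of_real (t j))) =
    vec (M + 1) (\<lambda>_. d)"
proof -
  obtain B where B: "mat_inverse (ader_M M t) = Some B" "ader_M M t * B = 1\<^sub>m (M + 1)"
    "B * ader_M M t = 1\<^sub>m (M + 1)" "B \<in> carrier_mat (M + 1) (M + 1)"
    using ader_M_inverse[OF inj] by metis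
  let ?c = "map_mat complex_of_real" and ?n = "M + 1"
  let ?M = "?c (ader_M M t)" and ?R = "?c (ader_R M t)" and ?T = "rk_resolvent_mat (ader_A M t) z"
  let ?v = "vec ?n (\<lambda>j. poly P (of_real (t j)))"
  have car: "?M \<in> carrier_mat ?n ?n" "?R \<in> carrier_mat ?n ?n" "?c B \<in> carrier_mat ?n ?n"
    using B(4) by (simp_all add: ader_M_def ader_R_def)
  have carr: "ader_M M t \<in> carrier_mat ?n ?n" "ader_R M t \<in> carrier_mat ?n ?n"
    by (simp_all add: ader_M_def ader_R_def)
  have A: "ader_A M t = B * ader_R M t" by (simp add: ader_A_def B(1))
  have BM: "?c B * ?M = 1\<^sub>m ?n"
    unfolding of_real_hom.mat_hom_mult[OF B(4) carr(1), symmetric] B(3)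
    by (rule of_real_hom.mat_hom_one)
  have cA: "?c (ader_A M t) = ?c B * ?R"
    unfolding A by (rule of_real_hom.mat_hom_mult[OF B(4) carr(2)])
  have T: "?T = ?c B * (?M - z \<cdot>\<^sub>m ?R)"
  proof -
    have "?c B * (?M - z \<cdot>\<^sub>m ?R) = ?c B * ?M - ?c B * (z \<cdot>\<^sub>m ?R)"
      using car by (intro mult_minus_distrib_mat) auto
    also have "?c B * (z \<cdot>\<^sub>m ?R) = z \<cdot>\<^sub>m (?c B * ?R)"
      using car by (intro mult_smult_distrib) auto
    also have "dim_row (ader_A M t) = ?n" using B(4) by (simp add: A)
    ultimately show ?thesis by (simp add: rk_resolvent_mat_def cA BM)
  qed
  have degL: "degree (map_poly of_real (lagrange_basis M t i) :: complex poly) \<le> M" if "i \<le> M" for i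
    using degree_lagrange_basis[OF that] by simp
  have "(?M - z \<cdot>\<^sub>m ?R) *\<^sub>v ?v =
      vec ?n (\<lambda>i. poly (map_poly of_real (lagrange_basis M t i)) 0 * d)"
    unfolding ader_matrices_mult_nodal_values[OF inj deg] by (rule eq_vecI) (use form degL in auto)
  also have "\<dots> = (?M - 0 \<cdot>\<^sub>m ?R) *\<^sub>v vec ?n (\<lambda>j. poly [:d:] (of_real (t j)))"
    by (subst ader_matrices_mult_nodal_values[OF inj]) (simp_all add: ader_form_by_parts)
  also have "?M - 0 \<cdot>\<^sub>m ?R = ?M"
    by (rule eq_matI) (auto simp: ader_M_def ader_R_def)
  finally have eq: "(?M - z \<cdot>\<^sub>m ?R) *\<^sub>v ?v = ?M *\<^sub>v vec ?n (\<lambda>_. d)" by simp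
  have "?T *\<^sub>v ?v = ?c B *\<^sub>v ((?M - z \<cdot>\<^sub>m ?R) *\<^sub>v ?v)"
    unfolding T using car by (intro assoc_mult_mat_vec) auto
  also have "\<dots> = (?c B * ?M) *\<^sub>v vec ?n (\<lambda>_. d)"
    unfolding eq using car by (intro assoc_mult_mat_vec[symmetric]) auto
  finally show ?thesis by (simp add: BM)
qed

lemma ader_b_scalar_prod:
  fixes P :: "complex poly"
  assumes "inj_on t {..M}" "degree P \<le> M"
  shows "map_vec complex_of_real (ader_b M t) \<bullet> vec (M + 1) (\<lambda>j. poly P (of_real (t j))) =
    unit_integral P"
proof -
  let ?L = "\<lambda>i. map_poly complex_of_real (lagrange_basis M t i)"
  have "unit_integral P = unit_integral (\<Sum>j\<le>M. smult (poly P (of_real (t j))) (?L j))"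
    by (subst lagrange_expansion[OF assms]) (rule refl)
  also have "\<dots> = (\<Sum>j = 0..<M + 1. complex_of_real (unit_integral (lagrange_basis M t j)) * poly P (of_real (t j)))"
    by (simp add: unit_integral_sum unit_integral_smult unit_integral_map_of_real
        atLeast0LessThan lessThan_Suc_atMost mult.commute)
  also have "\<dots> = map_vec complex_of_real (ader_b M t) \<bullet> vec (M + 1) (\<lambda>j. poly P (of_real (t j)))"
    unfolding scalar_prod_def by (intro sum.cong) (auto simp: ader_b_def unit_integral_def)
  finally show ?thesis ..
qed

text \<open>Here \<open>v = d (Id - z A)\<^sup>-\<^sup>1 1\<close> for the nodal values \<open>v\<close> of \<open>P\<close>. If \<open>d\<close> were \<open>0\<close>, then \<open>P\<close> would vanish
  at all nodes; otherwise \<open>R(z) = 1 + z (\<integral> P) / d\<close>, and the equation tested with \<open>q = 1\<close> eliminates the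
  integral.\<close>

lemma ader_stability_function:
  fixes P :: "complex poly"
  assumes inj: "inj_on t {..M}" and deg: "degree P \<le> M" and nz: "P \<noteq> 0"
    and form: "\<And>q. degree q \<le> M \<Longrightarrow> ader_form z q P = poly q 0 * d"
    and inv: "invertible_mat (rk_resolvent_mat (ader_A M t) z)"
  shows "d \<noteq> 0" "stability_function (ader_A M t) (ader_b M t) z = poly P 1 / d"
proof -
  let ?T = "rk_resolvent_mat (ader_A M t) z" and ?n = "M + 1"
  let ?v = "vec ?n (\<lambda>j. poly P (of_real (t j)))"
  obtain B where B: "mat_inverse (ader_M M t) = Some B" "B \<in> carrier_mat ?n ?n"
    using ader_M_inverse[OF inj] by metis
  have dimA: "dim_row (ader_A M t) = ?n" "dim_col (ader_A M t) = ?n"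
    using B by (simp_all add: ader_A_def ader_R_def)
  have T: "?T \<in> carrier_mat ?n ?n"
    unfolding rk_resolvent_mat_def using dimA by auto
  obtain C where C: "mat_inverse ?T = Some C" "C * ?T = 1\<^sub>m ?n" "C \<in> carrier_mat ?n ?n"
    using invertible_mat_inverse[OF T inv] by metis
  have "?v = (C * ?T) *\<^sub>v ?v" by (simp add: C(2))
  also have "\<dots> = C *\<^sub>v (?T *\<^sub>v ?v)"
    using C(3) T by (intro assoc_mult_mat_vec) auto
  also have "?T *\<^sub>v ?v = vec ?n (\<lambda>_. d)"
    by (rule ader_resolvent_mult[OF inj deg]) (rule form)
  also have "vec ?n (\<lambda>_. d) = d \<cdot>\<^sub>v vec ?n (\<lambda>_. 1)"
    by (rule eq_vecI) auto
  also have "C *\<^sub>v (d \<cdot>\<^sub>v vec ?n (\<lambda>_. 1)) = d \<cdot>\<^sub>v (C *\<^sub>v vec ?n (\<lambda>_. 1))"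
    using C(3) by (intro mult_mat_vec) auto
  finally have v: "?v = d \<cdot>\<^sub>v (C *\<^sub>v vec ?n (\<lambda>_. 1))" .
  show d: "d \<noteq> 0"
  proof
    assume d0: "d = 0"
    have "poly P (of_real (t j)) = 0" if "j \<le> M" for j
      using arg_cong[OF v, of "\<lambda>w. w $ j"] that C(3) d0 by simp
    hence "P = 0"
      by (subst lagrange_expansion[OF inj deg, symmetric]) simp
    with nz show False by contradiction
  qed
  have "d * (map_vec complex_of_real (ader_b M t) \<bullet> (C *\<^sub>v vec ?n (\<lambda>_. 1))) =
      map_vec complex_of_real (ader_b M t) \<bullet> ?v"
    unfolding v using C(3) by (subst scalar_prod_smult_distrib[of _ ?n]) (auto simp: ader_b_def)
  also have "\<dots> = unit_integral P" by (rule ader_b_scalar_prod[OF inj deg])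
  finally have "stability_function (ader_A M t) (ader_b M t) z = 1 + z * unit_integral P / d"
    unfolding stability_function_def C(1) dimA using d by (simp add: field_simps)
  moreover have "poly P 1 - z * unit_integral P = d"
    using form[of 1] by (simp add: ader_form_def)
  ultimately show "stability_function (ader_A M t) (ader_b M t) z = poly P 1 / d"
    using d by (simp add: field_simps)
qed

theorem theorem3p6:
  fixes M :: nat and t :: "nat \<Rightarrow> real"
  assumes "gauss_legendre_nodes M t"
  shows "\<exists>N D. pade_exp M (M + 1) N D \<and> degree N = M \<and> degree D = M + 1 \<and>
           (\<forall>z. invertible_mat (rk_resolvent_mat (ader_A M t) z) \<longrightarrow>
              poly D z \<noteq> 0 \<and>
              stability_function (ader_A M t) (ader_b M t) z = poly N z / poly D z)"
proof -
  have inj: "inj_on t {..M}"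
    using assms by (simp add: gauss_legendre_nodes_def bij_betw_def)
  define F :: "complex poly" where "F = [:0, 1:] ^ M * [:-1, 1:] ^ (M + 1)"
  have F: "F \<noteq> 0" and ord: "order 0 F = M" "order 1 F = M + 1" and deg: "degree F = 2 * M + 1"
    unfolding F_def using two_root_poly[of M "M + 1", where 'a = complex] by simp_all
  define c where "c = poly (hermite_value (2 * M + 1) F 0) 0"
  define N where "N = smult (1 / c) (hermite_value (2 * M + 1) F 1)"
  define D where "D = smult (1 / c) (hermite_value (2 * M + 1) F 0)"
  have c: "c \<noteq> 0" and pade: "pade_exp M (M + 1) N D"
    using pade_exp_hermite[OF F] deg ord by (simp_all add: N_def D_def c_def)
  have degs: "degree N = M" "degree D = M + 1"
    using c F ord by (simp_all add: N_def D_def degree_hermite_value)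
  have "poly D z \<noteq> 0 \<and> stability_function (ader_A M t) (ader_b M t) z = poly N z / poly D z"
    if inv: "invertible_mat (rk_resolvent_mat (ader_A M t) z)" for z
  proof -
    note P = ader_form_hermite_sum[OF F deg ord, where z = z]
    from ader_stability_function[OF inj P(1,4,3) inv] P(2)
    show ?thesis using c by (simp add: N_def D_def)
  qed
  with pade degs show ?thesis by blast
qed

end
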